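(* If a topological space $X$ satisfies the selection principle $\mathsf{S}_1(\mathcal{G}_K,\mathcal{G}_{\overline{\Gamma}})$, then $X$ is productively almost Scheepers, i.e. $X\times Y$ is almost Scheepers for every almost Scheepers space $Y$.
   Context: For a space $X$: $\mathcal{G}_K$ is the class of all families $\mathcal{U}$ of $G_\delta$ subsets of $X$ such that $X\notin\mathcal{U}$ and every compact set $C\subseteq X$ is contained in some $U\in\mathcal{U}$. $\mathcal{G}_{\overline{\Gamma}}$ is the class of all infinite covers $\mathcal{U}$ of $X$ by $G_\delta$ sets such that for each $x\in X$ the set $\{U\in\mathcal{U}:x\notin\overline{U}\}$ is finite. $X$ satisfies $\mathsf{S}_1(\mathcal{A},\mathcal{B})$ if for each sequence $(\mathcal{U}_n)_{n\in\mathbb{N}}$ of elements of $\mathcal{A}$ there are $V_n\in\mathcal{U}_n$ ($n\in\mathbb{N}$) with $\{V_n:n\in\mathbb{N}\}\in\mathcal{B}$. A space $Z$ is almost Scheepers if for every sequence $(\mathcal{U}_n)_{n\in\mathbb{N}}$ of open covers of $Z$ there are finite $\mathcal{V}_n\subseteq\mathcal{U}_n$ such that every finite set $F\subseteq Z$ is contained in $\overline{\bigcup\mathcal{V}_n}$ for some $n$ (equivalently, for infinitely many $n$). *)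

theory Defs
  imports "HOL-Analysis.Analysis"
begin

definition G_K :: "'a topology \<Rightarrow> 'a set set set" where
  "G_K X = {\<U>. (\<forall>U\<in>\<U>. gdelta_in X U) \<and> topspace X \<notin> \<U> \<and>
                (\<forall>C. compactin X C \<longrightarrow> (\<exists>U\<in>\<U>. C \<subseteq> U))}"

definition G_Gamma_bar :: "'a topology \<Rightarrow> 'a set set set" where
  "G_Gamma_bar X = {\<U>. infinite \<U> \<and> (\<forall>U\<in>\<U>. gdelta_in X U) \<and> \<Union>\<U> = topspace X \<and>
                (\<forall>x\<in>topspace X. finite {U\<in>\<U>. x \<notin> X closure_of U})}"

definition S1 :: "'a set set set \<Rightarrow> 'a set set set \<Rightarrow> bool" where
  "S1 \<A> \<B> \<longleftrightarrow>
     (\<forall>\<U>::nat \<Rightarrow> 'a set set. (\<forall>n. \<U> n \<in> \<A>) \<longrightarrow>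
        (\<exists>V. (\<forall>n. V n \<in> \<U> n) \<and> range V \<in> \<B>))"

definition open_cover :: "'a topology \<Rightarrow> 'a set set \<Rightarrow> bool" where
  "open_cover X \<U> \<longleftrightarrow> (\<forall>U\<in>\<U>. openin X U) \<and> \<Union>\<U> = topspace X"

definition almost_Scheepers :: "'a topology \<Rightarrow> bool" where
  "almost_Scheepers Z \<longleftrightarrow>
     (\<forall>\<U>::nat \<Rightarrow> 'a set set. (\<forall>n. open_cover Z (\<U> n)) \<longrightarrow>
        (\<exists>\<V>. (\<forall>n. finite (\<V> n) \<and> \<V> n \<subseteq> \<U> n) \<and>
             (\<forall>F. finite F \<and> F \<subseteq> topspace Z \<longrightarrow> (\<exists>n. F \<subseteq> Z closure_of \<Union>(\<V> n)))))"

end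

theory Submission
  imports Defs
begin

text \<open>For every compact set $K \subseteq X$, the tube lemma turns the covers of $X \times Y$ into
  covers of $Y$, to which the almost Scheepers property applies; this yields open sets
  $O_n \supseteq K$ whose intersection $G_K$ is a $G_\delta$ set containing $K$. If some $G_K$ is all
  of $X$, then this $K$ alone is enough (this covers compact $X$, where the selection hypothesis is
  vacuous). Otherwise the sets $G_K$ form a member of $\mathcal{G}_K$, and the selection principle
  gives countably many compact sets $K_m$ such that every finite subset of $X$ lies in the closure of
  some $G_{K_m}$. A diagonal union over $m \le n$ of the selections for the $K_m$ finishes the proof.\<close>

text \<open>Apply the property to every tail of the sequence of covers: a success for the tail
  starting at \<open>m\<close> happens at an index at least \<open>m\<close>. Such arbitrarily late
  successes are what the diagonal union in the theorem needs.\<close>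

lemma almost_Scheepers_frequently:
  assumes "almost_Scheepers Y" and cov: "\<And>n::nat. open_cover Y (\<U> n)"
  obtains \<V> where "\<And>n. finite (\<V> n)" "\<And>n. \<V> n \<subseteq> \<U> n"
    "\<And>F m. finite F \<Longrightarrow> F \<subseteq> topspace Y \<Longrightarrow> \<exists>n\<ge>m. F \<subseteq> Y closure_of \<Union>(\<V> n)"
proof -
  have "\<exists>\<V>. (\<forall>n. finite (\<V> n) \<and> \<V> n \<subseteq> \<U> (n + m)) \<and>
          (\<forall>F. finite F \<and> F \<subseteq> topspace Y \<longrightarrow> (\<exists>n. F \<subseteq> Y closure_of \<Union>(\<V> n)))" for m
    using assms(1)[unfolded almost_Scheepers_def, rule_format, of "\<lambda>n. \<U> (n + m)"] cov
    by blast
  then obtain \<W> where W: "\<And>m n. finite (\<W> m n)" "\<And>m n. \<W> m n \<subseteq> \<U> (n + m)"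
    and WF: "\<And>m F. finite F \<Longrightarrow> F \<subseteq> topspace Y \<Longrightarrow> \<exists>n. F \<subseteq> Y closure_of \<Union>(\<W> m n)"
    by metis
  \<comment> \<open>Entry \<open>n - m\<close> of the tail starting at \<open>m\<close> is a
    selection from \<open>\<U> n\<close>. Only the finitely many tails with \<open>m \<le> n\<close>
    reach index \<open>n\<close>, so their union stays finite.\<close>
  define \<V> where "\<V> n = (\<Union>m\<le>n. \<W> m (n - m))" for n
  show thesis
  proof
    show "finite (\<V> n)" for n
      by (simp add: \<V>_def W)
    show "\<V> n \<subseteq> \<U> n" for n
      unfolding \<V>_def using W(2) by fastforce
    show "\<exists>n\<ge>m. F \<subseteq> Y closure_of \<Union>(\<V> n)" if F: "finite F" "F \<subseteq> topspace Y" for F m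
    proof -
      obtain n where n: "F \<subseteq> Y closure_of \<Union>(\<W> m n)"
        using WF[OF F] by blast
      have "\<W> m n \<subseteq> \<V> (n + m)"
        using UN_upper[of m "{..n + m}" "\<lambda>m'. \<W> m' (n + m - m')"] by (simp add: \<V>_def)
      then have "F \<subseteq> Y closure_of \<Union>(\<V> (n + m))"
        using n closure_of_mono[of "\<Union>(\<W> m n)" "\<Union>(\<V> (n + m))" Y] by blast
      then show ?thesis
        using le_add2 by blast
    qed
  qed
qed

text \<open>The slice \<open>K \<times> {y}\<close> is compact, so finitely many members of the
  cover contain it; Wallace's theorem then fits an open box around the slice into their
  union.\<close>

lemma tube_finite_subcover:
  assumes K: "compactin X K" and y: "y \<in> topspace Y"
    and cov: "open_cover (prod_topology X Y) \<U>"
  obtains T V \<W> where "openin X T" "openin Y V" "K \<subseteq> T" "y \<in> V"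
    "finite \<W>" "\<W> \<subseteq> \<U>" "T \<times> V \<subseteq> \<Union>\<W>"
proof -
  have "compactin (prod_topology X Y) (K \<times> {y})"
    using K y by (simp add: compactin_Times)
  moreover have "K \<times> {y} \<subseteq> \<Union>\<U>"
    using compactin_subset_topspace[OF K] y cov by (auto simp: open_cover_def)
  ultimately obtain \<W> where W: "finite \<W>" "\<W> \<subseteq> \<U>" "K \<times> {y} \<subseteq> \<Union>\<W>"
    using cov unfolding open_cover_def by (meson compactinD)
  have "openin (prod_topology X Y) (\<Union>\<W>)"
    using cov W(2) by (auto simp: open_cover_def)
  then obtain T V where "openin X T" "openin Y V" "K \<subseteq> T" "{y} \<subseteq> V" "T \<times> V \<subseteq> \<Union>\<W>"
    using Wallace_theorem_prod_topology[of X K Y "{y}" "\<Union>\<W>"] K y W(3) by auto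
  with W that show thesis
    by blast
qed

text \<open>Here \<open>P n\<close> is the union of the finite selection made in \<open>Y\<close>.
  Because that selection is finite, the tubes over its members can be cut down to one open set
  \<open>T n\<close> around \<open>K\<close>.\<close>

lemma almost_Scheepers_tubes:
  assumes Y: "almost_Scheepers Y" and K: "compactin X K"
    and cov: "\<And>n::nat. open_cover (prod_topology X Y) (\<U> n)"
  shows "\<exists>T P \<W>. (\<forall>n. openin X (T n) \<and> K \<subseteq> T n \<and> finite (\<W> n) \<and> \<W> n \<subseteq> \<U> n \<and>
                       T n \<times> P n \<subseteq> \<Union>(\<W> n)) \<and>
           (\<forall>F m. finite F \<and> F \<subseteq> topspace Y \<longrightarrow> (\<exists>n\<ge>m. F \<subseteq> Y closure_of P n))"
proof -
  define tube where "tube n V T \<W> \<longleftrightarrow>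
      openin X T \<and> K \<subseteq> T \<and> finite \<W> \<and> \<W> \<subseteq> \<U> n \<and> T \<times> V \<subseteq> \<Union>\<W>" for n V T \<W>
  \<comment> \<open>These are the open sets of \<open>Y\<close> over which some tube around
    \<open>K\<close> is covered by finitely many members of \<open>\<U> n\<close>.\<close>
  define \<C> where "\<C> n = {V. openin Y V \<and> (\<exists>T \<W>. tube n V T \<W>)}" for n
  have "open_cover Y (\<C> n)" for n
    unfolding open_cover_def
  proof
    show "\<forall>U\<in>\<C> n. openin Y U"
      by (simp add: \<C>_def)
    show "\<Union>(\<C> n) = topspace Y"
    proof
      show "\<Union>(\<C> n) \<subseteq> topspace Y"
        by (auto simp: \<C>_def dest: openin_subset)
      show "topspace Y \<subseteq> \<Union>(\<C> n)"
      proof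
        fix y assume "y \<in> topspace Y"
        then obtain T V \<W> where "openin Y V" "y \<in> V" "tube n V T \<W>"
          using tube_finite_subcover[OF K _ cov[of n]] unfolding tube_def by metis
        then show "y \<in> \<Union>(\<C> n)"
          by (auto simp: \<C>_def)
      qed
    qed
  qed
  then obtain \<V> where V: "\<And>n. finite (\<V> n)" "\<And>n. \<V> n \<subseteq> \<C> n"
    and VF: "\<And>F m. finite F \<Longrightarrow> F \<subseteq> topspace Y \<Longrightarrow> \<exists>n\<ge>m. F \<subseteq> Y closure_of \<Union>(\<V> n)"
    using almost_Scheepers_frequently[OF Y, of \<C>] by metis
  have "\<forall>n. \<forall>V\<in>\<V> n. \<exists>T \<W>. tube n V T \<W>"
    using V(2) unfolding \<C>_def by blast
  then obtain t w where tw: "\<And>n V. V \<in> \<V> n \<Longrightarrow> tube n V (t n V) (w n V)"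
    by metis
  \<comment> \<open>The empty selection is treated separately because \<open>\<Inter>{}\<close> is
    \<open>UNIV\<close>, which need not be open in \<open>X\<close>. In that case
    \<open>\<Union>(\<V> n)\<close> is empty and the box inclusion is trivial.\<close>
  define T where "T n = (if \<V> n = {} then topspace X else \<Inter>(t n ` \<V> n))" for n
  have t: "openin X (t n V)" "K \<subseteq> t n V" and w: "finite (w n V)" "w n V \<subseteq> \<U> n"
    if "V \<in> \<V> n" for n V
    using tw[OF that] by (simp_all add: tube_def)
  have "openin X (T n)" for n
    using V(1) t(1) unfolding T_def by (auto intro!: openin_Inter)
  moreover have "K \<subseteq> T n" for n
    using compactin_subset_topspace[OF K] t(2) by (simp add: T_def INT_greatest)
  moreover have "finite (\<Union>(w n ` \<V> n))" "\<Union>(w n ` \<V> n) \<subseteq> \<U> n" for n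
    using V(1) w by (simp_all add: UN_subset_iff)
  moreover have "T n \<times> \<Union>(\<V> n) \<subseteq> \<Union>(\<Union>(w n ` \<V> n))" for n
  proof
    fix p assume p: "p \<in> T n \<times> \<Union>(\<V> n)"
    then obtain V where V: "V \<in> \<V> n" "snd p \<in> V"
      by auto
    then have "p \<in> t n V \<times> V"
      using p unfolding T_def by (auto split: if_splits)
    also have "t n V \<times> V \<subseteq> \<Union>(w n V)"
      using tw[OF V(1)] by (simp add: tube_def)
    finally show "p \<in> \<Union>(\<Union>(w n ` \<V> n))"
      using V(1) by blast
  qed
  ultimately show ?thesis
    using VF by (intro exI[of _ T] exI[of _ "\<lambda>n. \<Union>(\<V> n)"] exI[of _ "\<lambda>n. \<Union>(w n ` \<V> n)"]) auto
qed

lemma closure_of_Times_subset: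
  assumes "A \<times> B \<subseteq> C" and "fst ` F \<subseteq> X closure_of A" and "snd ` F \<subseteq> Y closure_of B"
  shows "F \<subseteq> prod_topology X Y closure_of C"
proof -
  have "F \<subseteq> (X closure_of A) \<times> (Y closure_of B)"
    using assms(2,3) by force
  then show ?thesis
    using closure_of_mono[OF assms(1), of "prod_topology X Y"] by (auto simp: closure_of_Times)
qed

theorem theorem4p4:
  fixes X :: "'a topology" and Y :: "'b topology"
  assumes "S1 (G_K X) (G_Gamma_bar X)"
    and "almost_Scheepers Y"
  shows "almost_Scheepers (prod_topology X Y)"
  unfolding almost_Scheepers_def
proof (intro allI impI)
  fix \<U> :: "nat \<Rightarrow> ('a \<times> 'b) set set"
  assume cov: "\<forall>n. open_cover (prod_topology X Y) (\<U> n)"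
  define tubes where "tubes K T P \<W> \<longleftrightarrow>
      (\<forall>n. openin X (T n) \<and> K \<subseteq> T n \<and> finite (\<W> n) \<and> \<W> n \<subseteq> \<U> n \<and> T n \<times> P n \<subseteq> \<Union>(\<W> n)) \<and>
      (\<forall>F m. finite F \<and> F \<subseteq> topspace Y \<longrightarrow> (\<exists>n\<ge>m. F \<subseteq> Y closure_of P n))" for K T P \<W>
  have "\<exists>T P \<W>. tubes K T P \<W>" if "compactin X K" for K
    using almost_Scheepers_tubes[OF assms(2) that, of \<U>] cov unfolding tubes_def by blast
  then obtain T P \<W> where "\<And>K. compactin X K \<Longrightarrow> tubes K (T K) (P K) (\<W> K)"
    by metis
  then have T: "\<And>K n. compactin X K \<Longrightarrow> openin X (T K n)" "\<And>K n. compactin X K \<Longrightarrow> K \<subseteq> T K n"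
    and W: "\<And>K n. compactin X K \<Longrightarrow> finite (\<W> K n)" "\<And>K n. compactin X K \<Longrightarrow> \<W> K n \<subseteq> \<U> n"
    and TP: "\<And>K n. compactin X K \<Longrightarrow> T K n \<times> P K n \<subseteq> \<Union>(\<W> K n)"
    and P: "\<And>K F m. compactin X K \<Longrightarrow> finite F \<Longrightarrow> F \<subseteq> topspace Y
               \<Longrightarrow> \<exists>n\<ge>m. F \<subseteq> Y closure_of P K n"
    by (simp_all add: tubes_def)
  \<comment> \<open>Intersecting over all \<open>n\<close> gives a single set that works with every
    cover at once; it is in general no longer open, only a \<open>G_\<delta>\<close> set.\<close>
  define G where "G K = (\<Inter>n. T K n)" for K
  have GP: "G K \<times> P K n \<subseteq> \<Union>(\<W> K n)" if "compactin X K" for K n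
    using TP[OF that, of n] unfolding G_def by blast
  \<comment> \<open>This reduces capturing \<open>F\<close> to a condition on its first coordinates:
    the second coordinates are caught by \<open>P K n\<close> at arbitrarily late
    \<open>n\<close>.\<close>
  have closure: "\<exists>n\<ge>m. F \<subseteq> prod_topology X Y closure_of \<Union>(\<W> K n)"
    if K: "compactin X K" and F: "finite F" "F \<subseteq> topspace (prod_topology X Y)"
      and FG: "fst ` F \<subseteq> X closure_of G K" for K F m
  proof -
    have "finite (snd ` F)" "snd ` F \<subseteq> topspace Y"
      using F by auto
    then obtain n where "n \<ge> m" "snd ` F \<subseteq> Y closure_of P K n"
      using P[OF K] by blast
    then show ?thesis
      using closure_of_Times_subset[OF GP[OF K] FG] by blast
  qed
  show "\<exists>\<V>. (\<forall>n. finite (\<V> n) \<and> \<V> n \<subseteq> \<U> n) \<and>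
          (\<forall>F. finite F \<and> F \<subseteq> topspace (prod_topology X Y) \<longrightarrow>
               (\<exists>n. F \<subseteq> prod_topology X Y closure_of \<Union>(\<V> n)))"
  proof (cases "\<exists>K. compactin X K \<and> G K = topspace X")
    case True
    then obtain K where K: "compactin X K" "G K = topspace X"
      by blast
    have "\<exists>n. F \<subseteq> prod_topology X Y closure_of \<Union>(\<W> K n)"
      if F: "finite F" "F \<subseteq> topspace (prod_topology X Y)" for F
    proof -
      have "fst ` F \<subseteq> X closure_of G K"
        using F K(2) by auto
      then show ?thesis
        using closure[OF K(1) F] by blast
    qed
    with W K(1) show ?thesis
      by (intro exI[of _ "\<W> K"]) blast
  next
    case False
    have "gdelta_in X (G K)" if "compactin X K" for K
      unfolding G_def using T(1)[OF that]
      by (intro gdelta_in_Inter) (auto intro: open_imp_gdelta_in)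
    moreover have "K \<subseteq> G K" if "compactin X K" for K
      unfolding G_def using T(2)[OF that] by blast
    ultimately have "G ` Collect (compactin X) \<in> G_K X"
      using False unfolding G_K_def by blast
    \<comment> \<open>The principle is applied to a constant sequence, since \<open>G K\<close>
      already takes all the covers into account.\<close>
    then obtain V where V: "\<And>n::nat. V n \<in> G ` Collect (compactin X)"
      and "range V \<in> G_Gamma_bar X"
      using assms(1)[unfolded S1_def, rule_format, of "\<lambda>_. G ` Collect (compactin X)"] by blast
    then have Vinf: "infinite (range V)"
      and Vfin: "\<And>x. x \<in> topspace X \<Longrightarrow> finite {U \<in> range V. x \<notin> X closure_of U}"
      by (auto simp: G_Gamma_bar_def)
    have "\<exists>K. compactin X K \<and> V n = G K" for n
      using V[of n] by blast
    then obtain K where K: "\<And>n. compactin X (K n)" "\<And>n. V n = G (K n)"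
      by metis
    \<comment> \<open>Restricting to \<open>m \<le> n\<close> keeps the union finite. The selection
      for \<open>K m\<close> thus enters only from index \<open>m\<close> on, so a success at some
      \<open>n \<ge> m\<close> is required.\<close>
    define \<V> where "\<V> n = (\<Union>m\<le>n. \<W> (K m) n)" for n
    have "\<exists>n. F \<subseteq> prod_topology X Y closure_of \<Union>(\<V> n)"
      if F: "finite F" "F \<subseteq> topspace (prod_topology X Y)" for F
    proof -
      \<comment> \<open>Each first coordinate lies outside the closures of only finitely many
        members of the infinite set \<open>range V\<close>, so some member has all of them in its
        closure.\<close>
      have "finite (\<Union>x\<in>fst ` F. {U \<in> range V. x \<notin> X closure_of U})"
        using F by (intro finite_UN_I Vfin) auto
      then obtain U where "U \<in> range V" "U \<notin> (\<Union>x\<in>fst ` F. {U \<in> range V. x \<notin> X closure_of U})"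
        using Vinf by (meson finite_subset subsetI)
      then obtain m where "fst ` F \<subseteq> X closure_of G (K m)"
        using K(2) by auto
      then obtain n where n: "n \<ge> m" "F \<subseteq> prod_topology X Y closure_of \<Union>(\<W> (K m) n)"
        using closure[OF K(1) F] by blast
      have "\<Union>(\<W> (K m) n) \<subseteq> \<Union>(\<V> n)"
        unfolding \<V>_def using n(1) by blast
      then show ?thesis
        using n(2) closure_of_mono by blast
    qed
    moreover have "finite (\<V> n)" "\<V> n \<subseteq> \<U> n" for n
      unfolding \<V>_def using W[OF K(1)] by (simp_all add: UN_subset_iff)
    ultimately show ?thesis
      by (intro exI[of _ \<V>]) simp
  qed
qed

end
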